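(* For each integer $r\ge 3$ let $f_{r,1}(x)=1+x+x^{2^r-1}+x^{2^r+1}\in\mathbb{F}_2[x]$. Then for every $r\geq 3$ the polynomial $f_{r,1}$ is robust and its order divides $4^r-1$; moreover $\displaystyle\lim_{r\to\infty}\gamma(f_{r,1})=1$.
   Context: For $f\in\mathbb{F}_2[x]$ with $f(0)=1$ and $\deg f\ge 1$, the order $\operatorname{ord}(f)$ is the least integer $D\ge 1$ such that $f(x)\mid 1+x^D$ in $\mathbb{F}_2[x]$. With $D=\operatorname{ord}(f)$, let $f^*(x)\in\mathbb{F}_2[x]$ be defined by $f(x)f^*(x)=1+x^D$. For $g\in\mathbb{F}_2[x]$, $\ell_1(g)$ is the number of monomials of $g$ (terms with coefficient $1$), and for $N\ge\deg g$, $\ell_{0,N}(g)$ is the number of exponents $k\in\{0,1,\dots,N\}$ for which the coefficient of $x^k$ in $g$ is $0$. Define $\gamma(f)=\ell_1(f^* )/D$. The polynomial $f$ is called robust if $\ell_1(f^* )>\ell_{0,D-1}(f^* )+1$, equivalently $\ell_1(f^* )>(D+1)/2$. *)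

theory Defs
  imports Complex_Main "HOL-Library.Z2" "HOL-Computational_Algebra.Polynomial"
begin

text \<open>
  The field with two elements is the library type \<^typ>\<open>bit\<close>, so the ring of binary polynomials
  is \<^typ>\<open>bit poly\<close>, with \<open>monom 1 n\<close> for \<open>x ^ n\<close>. The order, the cofactor \<open>f\<^sup>*\<close> and everything
  built on them are meaningful for \<open>coeff f 0 = 1\<close> and \<open>degree f \<ge> 1\<close>; see the lemmas
  \<open>poly_ord_props\<close> and \<open>ex1_cofactor\<close> below.
\<close>

definition poly_ord :: "bit poly \<Rightarrow> nat" where
  "poly_ord f = (LEAST D. D \<ge> 1 \<and> f dvd 1 + monom 1 D)"

definition cofactor :: "bit poly \<Rightarrow> bit poly" where
  "cofactor f = (THE g. f * g = 1 + monom 1 (poly_ord f))"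

definition num_ones :: "bit poly \<Rightarrow> nat" where
  "num_ones g = card {k. coeff g k = 1}"

definition num_zeros :: "nat \<Rightarrow> bit poly \<Rightarrow> nat" where
  "num_zeros N g = card {k \<in> {0..N}. coeff g k = 0}"

definition gamma_ratio :: "bit poly \<Rightarrow> real" where
  "gamma_ratio f = real (num_ones (cofactor f)) / real (poly_ord f)"

definition robust :: "bit poly \<Rightarrow> bool" where
  "robust f \<longleftrightarrow>
     num_ones (cofactor f) > num_zeros (poly_ord f - 1) (cofactor f) + 1"

definition f_r1 :: "nat \<Rightarrow> bit poly" where
  "f_r1 r = 1 + monom 1 1 + monom 1 (2 ^ r - 1) + monom 1 (2 ^ r + 1)"

lemma finite_bit_poly_degree_le: "finite {p :: bit poly. degree p \<le> n}"
proof (rule finite_imageD)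
  let ?c = "\<lambda>p :: bit poly. {k. coeff p k = 1}"
  have "k \<le> n" if "degree p \<le> n" "coeff p k = 1" for p :: "bit poly" and k
    using le_degree[of p k] that by simp
  then have "?c ` {p. degree p \<le> n} \<subseteq> Pow {..n}"
    by auto
  then show "finite (?c ` {p. degree p \<le> n})"
    by (rule finite_subset) simp
  show "inj_on ?c {p. degree p \<le> n}"
  proof (rule inj_onI)
    fix p q :: "bit poly"
    assume "?c p = ?c q"
    then have "coeff p k = 1 \<longleftrightarrow> coeff q k = 1" for k by blast
    then show "p = q"
      by (intro poly_eqI) (metis bit_not_one_iff)
  qed
qed

lemma dvd_monom_mult_cancel:
  fixes f g :: "bit poly"
  assumes "coeff f 0 = 1" "f dvd monom 1 i * g"
  shows "f dvd g"
  using assms(2)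
proof (induction i)
  case 0
  then show ?case by (simp add: monom_0 flip: one_pCons)
next
  case (Suc i)
  have "monom 1 (Suc i) * g = pCons 0 (monom 1 i * g)"
    by (simp add: monom_Suc)
  with Suc.prems obtain h where h: "pCons 0 (monom 1 i * g) = f * h"
    by (auto simp: dvd_def)
  obtain a h' where h': "h = pCons a h'" by (cases h)
  have "coeff (f * h) 0 = 0" by (metis coeff_pCons_0 h)
  then have "a = 0" using assms(1) h' by (simp add: coeff_mult)
  with h h' have "monom 1 i * g = f * h'" by simp
  then have "f dvd monom 1 i * g" by simp
  then show ?case by (rule Suc.IH)
qed

lemma ex_poly_ord:
  fixes f :: "bit poly"
  assumes "coeff f 0 = 1"
  shows "\<exists>D\<ge>1. f dvd 1 + monom 1 D"
proof -
  let ?r = "\<lambda>n. monom 1 n mod f"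
  have f0: "f \<noteq> 0" using assms by auto
  have "range ?r \<subseteq> {p. degree p \<le> degree f}"
    using degree_mod_less[OF f0] by (metis (mono_tags, lifting) degree_0 image_subsetI le0 less_imp_le mem_Collect_eq)
  then have "finite (range ?r)"
    using finite_bit_poly_degree_le finite_subset by blast
  then have "\<not> inj ?r" using finite_imageD infinite_UNIV_nat by blast
  then obtain i j where ij: "i < j" "?r i = ?r j"
    unfolding inj_def by (metis linorder_neqE_nat)
  then have "f dvd monom 1 j - monom 1 i" by (metis mod_eq_dvd_iff)
  moreover have "monom 1 j - monom 1 i = monom 1 i * (1 + monom (1::bit) (j - i))"
  proof -
    have "monom 1 j - monom 1 i = monom (1::bit) i + monom 1 j" by (rule poly_eqI) simp
    moreover have "i + (j - i) = j" using ij(1) by simp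
    ultimately show ?thesis by (simp add: distrib_left mult_monom)
  qed
  ultimately have "f dvd 1 + monom 1 (j - i)"
    using dvd_monom_mult_cancel[OF assms] by metis
  with ij show ?thesis by (intro exI[of _ "j - i"]) auto
qed

lemma poly_ord_props:
  fixes f :: "bit poly"
  assumes "coeff f 0 = 1"
  shows "poly_ord f \<ge> 1" "f dvd 1 + monom 1 (poly_ord f)"
  using LeastI_ex[OF ex_poly_ord[OF assms]] unfolding poly_ord_def by blast+

lemma ex1_cofactor:
  fixes f :: "bit poly"
  assumes "coeff f 0 = 1"
  shows "\<exists>!g. f * g = 1 + monom 1 (poly_ord f)"
proof -
  have "f \<noteq> 0" using assms by auto
  moreover obtain g where "1 + monom 1 (poly_ord f) = f * g"
    using poly_ord_props(2)[OF assms] by (rule dvdE)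
  ultimately show ?thesis by (metis mult_left_cancel)
qed

end

theory Submission
  imports Defs
begin

text \<open>
  Write \<open>q = 2\<^sup>r\<close>, \<open>N = q\<^sup>2 - 1\<close> and \<open>y = x^(q-1) (1 + x)\<close>. Then \<open>f = (1 + x) (1 + y)\<close>. Since
  \<open>1 + y\<^sup>q\<close> is \<open>1 + y\<close> times the product of the \<open>r\<close> trinomials \<open>1 + y^(2^i)\<close>, it has a sparse
  cofactor, and adding \<open>x^(q(q-1))\<close> to it gives \<open>H\<close> with at most \<open>3\<^sup>r\<close> terms and
  \<open>(1 + y) H = 1 + x\<^sup>N\<close>. With \<open>J = 1 + x + \<dots> + x^(N-1)\<close>, the polynomial
  \<open>F = J + x^(q-1) H\<close> satisfies \<open>(1 + x) F = H\<close>, hence \<open>f F = 1 + x\<^sup>N\<close>: up to repetition \<open>F\<close> is the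
  cofactor \<open>f\<^sup>*\<close>, and at most \<open>3\<^sup>r\<close> of its \<open>4\<^sup>r - 1\<close> coefficients vanish.
\<close>

section \<open>Identities in characteristic 2\<close>

lemma bit_poly_add_self [simp]: "p + p = (0 :: bit poly)"
proof (rule poly_eqI)
  fix n
  have "b + b = 0" for b :: bit by (cases b) simp_all
  then show "coeff (p + p) n = coeff 0 n" by (simp only: coeff_add coeff_0)
qed

lemma bit_poly_two_eq_0 [simp]: "2 = (0 :: bit poly)"
  using bit_poly_add_self[of 1] by (simp only: one_add_one)

lemma bit_poly_add_self_left [simp]: "p + (p + q) = (q :: bit poly)"
  by (simp flip: add.assoc)

text \<open>Iterated Frobenius: squaring is additive because the cross terms cancel.\<close>

lemma bit_poly_power_two_power_add:
  "(p + q :: bit poly) ^ 2 ^ n = p ^ 2 ^ n + q ^ 2 ^ n"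
proof (induction n)
  case (Suc n)
  have "(a + b) ^ 2 = a ^ 2 + b ^ 2" for a b :: "bit poly"
    by (simp add: power2_eq_square algebra_simps)
  with Suc show ?case
    by (simp add: power_mult mult.commute[of 2])
qed simp

lemma bit_poly_geometric_sum: "(1 + x) * (\<Sum>i<n. x ^ i) = 1 + (x :: bit poly) ^ n"
  by (induction n) (simp_all add: algebra_simps)

text \<open>Each factor equals \<open>(1 + y) ^ 2 ^ i\<close>, and the exponents 1 + (1 + 2 + ... +
  2^(n-1)) add up to 2^n.\<close>

lemma bit_poly_prod_two_power:
  "(1 + y) * (\<Prod>i<n. 1 + y ^ 2 ^ i) = 1 + (y :: bit poly) ^ 2 ^ n"
proof (induction n)
  case (Suc n)
  have "(1 + y) * (\<Prod>i<Suc n. 1 + y ^ 2 ^ i) = (1 + y ^ 2 ^ n) ^ 2"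
    using Suc by (simp add: power2_eq_square mult.assoc[symmetric])
  also have "\<dots> = 1 + y ^ 2 ^ Suc n"
    using bit_poly_power_two_power_add[of 1 "y ^ 2 ^ n" 1] by (simp flip: power_mult add: mult.commute)
  finally show ?case .
qed simp

section \<open>Number of terms under sums and products\<close>

lemma finite_ones [simp]: "finite {k. coeff (p :: bit poly) k = 1}"
  by (rule finite_subset[of _ "{..degree p}"]) (auto intro: le_degree)

lemma num_ones_0 [simp]: "num_ones 0 = 0"
  by (simp add: num_ones_def)

lemma num_ones_monom [simp]: "num_ones (monom 1 n) = 1"
proof -
  have "{k. coeff (monom 1 n) k = (1::bit)} = {n}" by auto
  then show ?thesis by (simp add: num_ones_def)
qed

lemma num_ones_1 [simp]: "num_ones 1 = 1"
  using num_ones_monom[of 0] by simp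

lemma num_ones_add_le: "num_ones (p + q) \<le> num_ones p + num_ones q"
proof -
  have "{k. coeff (p + q) k = 1} \<subseteq> {k. coeff p k = 1} \<union> {k. coeff q k = 1}"
    by (auto simp: bit_not_one_iff)
  then have "num_ones (p + q) \<le> card ({k. coeff p k = 1} \<union> {k. coeff q k = 1})"
    unfolding num_ones_def by (rule card_mono[rotated]) simp
  also have "\<dots> \<le> num_ones p + num_ones q"
    unfolding num_ones_def by (rule card_Un_le)
  finally show ?thesis .
qed

lemma num_ones_sum_le: "num_ones (\<Sum>i\<in>A. p i) \<le> (\<Sum>i\<in>A. num_ones (p i))"
proof (induction A rule: infinite_finite_induct)
  case (insert a A)
  then show ?case
    using num_ones_add_le[of "p a" "\<Sum>i\<in>A. p i"] by simp
qed simp_all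

lemma num_ones_mult_le: "num_ones (p * q) \<le> num_ones p * num_ones q"
proof -
  let ?S = "\<lambda>p :: bit poly. {k. coeff p k = 1}"
  have "?S (p * q) \<subseteq> (\<lambda>(i, j). i + j) ` (?S p \<times> ?S q)"
  proof
    fix n assume "n \<in> ?S (p * q)"
    then have "(\<Sum>i\<le>n. coeff p i * coeff q (n - i)) \<noteq> 0"
      by (simp add: coeff_mult)
    then obtain i where "i \<le> n" "coeff p i * coeff q (n - i) \<noteq> 0"
      by (meson atMost_iff sum.not_neutral_contains_not_neutral)
    then have "n = i + (n - i)" "i \<in> ?S p" "n - i \<in> ?S q"
      by auto
    then show "n \<in> (\<lambda>(i, j). i + j) ` (?S p \<times> ?S q)"
      by force
  qed
  then have "num_ones (p * q) \<le> card ((\<lambda>(i, j). i + j) ` (?S p \<times> ?S q))"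
    unfolding num_ones_def by (rule card_mono[rotated]) simp
  also have "\<dots> \<le> card (?S p \<times> ?S q)"
    by (rule card_image_le) simp
  finally show ?thesis
    by (simp add: num_ones_def)
qed

lemma num_ones_prod_le: "num_ones (\<Prod>i\<in>A. p i) \<le> (\<Prod>i\<in>A. num_ones (p i))"
proof (induction A rule: infinite_finite_induct)
  case (insert a A)
  then have "num_ones (p a * (\<Prod>i\<in>A. p i)) \<le> num_ones (p a) * (\<Prod>i\<in>A. num_ones (p i))"
    using num_ones_mult_le[of "p a"] mult_le_mono2 order_trans by blast
  with insert show ?case by simp
qed simp_all

lemma num_ones_plus_num_zeros:
  assumes "degree g \<le> N"
  shows "num_ones g + num_zeros N g = N + 1"
proof -
  have "num_ones g + num_zeros N g
      = card ({k. coeff g k = 1} \<union> {k \<in> {0..N}. coeff g k = 0})"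
    unfolding num_ones_def num_zeros_def by (rule card_Un_disjoint[symmetric]) auto
  also have "{k. coeff g k = 1} \<union> {k \<in> {0..N}. coeff g k = 0} = {0..N}"
    using assms le_degree[of g] by (fastforce simp: bit_not_one_iff)
  finally show ?thesis by simp
qed

lemma num_ones_all_ones: "num_ones (\<Sum>i<n. monom 1 i) = n"
proof -
  have "{k. coeff (\<Sum>i<n. monom (1::bit) i) k = 1} = {..<n}"
    by (auto simp: coeff_sum split: if_splits)
  then show ?thesis by (simp add: num_ones_def)
qed

section \<open>Order and cofactor\<close>

lemma X_power: "monom 1 1 ^ n = monom (1::'a::comm_semiring_1) n"
  by (simp add: monom_power)

lemma degree_one_plus_monom: "n \<ge> 1 \<Longrightarrow> degree (1 + monom (1::bit) n) = n"
  by (subst degree_add_eq_right) (auto simp: degree_monom_eq)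

text \<open>Division with remainder: a nonzero remainder \<open>s\<close> of \<open>N\<close> modulo
  the order would satisfy \<open>f dvd 1 + X ^ s\<close>, against minimality.\<close>

lemma poly_ord_dvd:
  assumes f: "coeff f 0 = 1" and N: "f dvd 1 + monom 1 N"
  shows "poly_ord f dvd N"
proof (rule ccontr)
  define X where "X = monom (1::bit) 1"
  have XP: "monom 1 k = X ^ k" for k
    unfolding X_def by (simp only: X_power)
  define D k s where "D = poly_ord f" and "k = N div D" and "s = N mod D"
  have D: "D \<ge> 1" "f dvd 1 + X ^ D"
    using poly_ord_props[OF f] by (simp_all only: D_def XP)
  assume "\<not> poly_ord f dvd N"
  with D have s: "s \<ge> 1" "s < D"
    by (auto simp: s_def D_def dvd_eq_mod_eq_0)
  have "1 + X ^ D dvd 1 + (X ^ D) ^ k"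
    by (metis bit_poly_geometric_sum dvd_triv_left)
  with D have "f dvd X ^ s * (1 + (X ^ D) ^ k)"
    by (meson dvd_mult dvd_trans)
  moreover have "N = D * k + s"
    by (simp add: k_def s_def)
  then have "1 + X ^ N = X ^ s * (1 + (X ^ D) ^ k) + (1 + X ^ s)"
    by (simp add: power_add power_mult algebra_simps)
  ultimately have "f dvd 1 + X ^ s"
    using N by (metis XP dvd_add_right_iff)
  with s show False
    unfolding D_def poly_ord_def by (metis XP not_less_Least)
qed

lemma cofactor_mult: "coeff f 0 = 1 \<Longrightarrow> f * cofactor f = 1 + monom 1 (poly_ord f)"
  unfolding cofactor_def by (rule theI'[OF ex1_cofactor])

lemma degree_cofactor:
  assumes "coeff f 0 = 1"
  shows "degree f + degree (cofactor f) = poly_ord f"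
proof -
  have D: "degree (f * cofactor f) = poly_ord f"
    using cofactor_mult[OF assms] poly_ord_props(1)[OF assms] degree_one_plus_monom by simp
  with poly_ord_props(1)[OF assms] have "f * cofactor f \<noteq> 0" by auto
  with D show ?thesis by (simp add: degree_mult_eq)
qed

text \<open>Up to the factor \<open>N / ord f\<close>, any multiple \<open>f * F = 1 + x\<^sup>N\<close> bounds the weight of the
  cofactor: \<open>F\<close> is a concatenation of \<open>N / ord f\<close> copies of it.\<close>
lemma num_ones_le_cofactor:
  assumes f: "coeff f 0 = 1" and F: "f * F = 1 + monom 1 (poly_ord f * M)"
  shows "num_ones F \<le> M * num_ones (cofactor f)"
proof -
  define S where "S = (\<Sum>i<M. monom (1::bit) (poly_ord f) ^ i)"
  have "f * F = f * (cofactor f * S)"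
    using bit_poly_geometric_sum[of "monom 1 (poly_ord f)" M] cofactor_mult[OF f] F
    by (simp add: S_def mult.assoc[symmetric] monom_power)
  moreover have "f \<noteq> 0" using f by auto
  ultimately have "F = cofactor f * S" by simp
  then have "num_ones F \<le> num_ones (cofactor f) * num_ones S"
    using num_ones_mult_le by simp
  also have "num_ones S \<le> M"
    using num_ones_sum_le[of "\<lambda>i. monom 1 (poly_ord f) ^ i" "{..<M}"]
    by (simp add: S_def monom_power)
  finally show ?thesis by (simp add: mult.commute)
qed

section \<open>A dense multiplier for \<open>f_r1 r\<close>\<close>

lemma f_r1_coeff_0: "r \<ge> 1 \<Longrightarrow> coeff (f_r1 r) 0 = 1"
  using one_less_power[of "2::nat" r] by (simp add: f_r1_def)

lemma degree_f_r1: "r \<ge> 1 \<Longrightarrow> degree (f_r1 r) = 2 ^ r + 1"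
proof -
  assume "r \<ge> 1"
  then have q: "(2::nat) ^ r > 1" by (rule one_less_power[rotated, OF less_le_trans[OF zero_less_one]]) simp
  show ?thesis unfolding f_r1_def
    by (subst degree_add_eq_right) 
      (use q in \<open>auto simp: degree_monom_eq intro!: degree_add_less\<close>)
qed

lemma f_r1_multiple:
  assumes "r \<ge> 1"
  obtains F where "f_r1 r * F = 1 + monom 1 (4 ^ r - 1)" "4 ^ r - 1 \<le> num_ones F + 3 ^ r"
proof -
  define X where "X = monom (1::bit) 1"
  have XP: "X ^ k = monom 1 k" for k
    unfolding X_def by (rule X_power)
  \<comment> \<open>With q = 2^r, \<open>n\<close> is q - 1; this gives N = (q - 1)(q + 1) = n (n +
    2) without truncated subtraction.\<close>
  obtain n where n: "2 ^ r = Suc n"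
    by (metis not0_implies_Suc power_not_zero zero_neq_numeral)
  have n1: "n \<ge> 1"
    using n one_less_power[of "2::nat" r] assms by simp
  define N :: nat where "N = n * (n + 2)"
  have N: "4 ^ r - 1 = N"
  proof -
    have "(4::nat) ^ r = (2 ^ r) * 2 ^ r" by (simp flip: power_mult_distrib)
    then show ?thesis by (simp add: n N_def)
  qed
  define y where "y = X ^ n * (1 + X)"
  define P where "P = (\<Prod>i<r. 1 + y ^ 2 ^ i)"
  define H where "H = P + X ^ (n * Suc n)"
  define F where "F = (\<Sum>k<N. X ^ k) + X ^ n * H"

  have f: "f_r1 r = (1 + X) * (1 + y)"
    unfolding f_r1_def n by (simp add: y_def XP[symmetric] X_def[symmetric] algebra_simps)
  have "y ^ 2 ^ r = (X ^ n) ^ 2 ^ r * (1 + X ^ 2 ^ r)"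
    using bit_poly_power_two_power_add[of 1 X r] by (simp add: y_def power_mult_distrib)
  then have "(1 + y) * P = 1 + X ^ (n * Suc n) * (1 + X ^ Suc n)"
    unfolding P_def bit_poly_prod_two_power by (simp only: n power_mult)
  \<comment> \<open>Multiplying the extra monomial of \<open>H\<close> by \<open>1 + y\<close>
    cancels both higher terms of \<open>(1 + y) * P\<close> and leaves \<open>X ^ N\<close>, as n (n
    + 1) + n = N.\<close>
  then have gH: "(1 + y) * H = 1 + X ^ N"
    by (simp add: H_def y_def N_def algebra_simps power_add)
  have "(1 + X) * F = (1 + X ^ N) + y * H"
    unfolding F_def by (simp add: distrib_left bit_poly_geometric_sum y_def mult_ac)
  also have "\<dots> = H"
    unfolding gH[symmetric] by (simp add: algebra_simps)
  finally have "(1 + y) * ((1 + X) * F) = 1 + monom 1 N"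
    by (simp only: gH XP)
  then have fF: "f_r1 r * F = 1 + monom 1 N"
    by (simp only: f mult_ac)

  \<comment> \<open>Counting the extra monomial of \<open>H\<close> separately would give 3^r + 1
    terms. Comparing degrees in \<open>gH\<close> saves the 1.\<close>
  have "degree (1 + y) = Suc n"
  proof -
    have "1 + y = (1 + monom 1 n) + monom 1 (Suc n)"
      by (simp add: y_def XP[symmetric] algebra_simps)
    also have "degree \<dots> = Suc n"
      using n1 by (subst degree_add_eq_right) (auto simp: degree_monom_eq degree_one_plus_monom)
    finally show ?thesis .
  qed
  moreover have "degree ((1 + y) * H) = N"
    using n1 by (simp add: gH XP degree_one_plus_monom N_def)
  moreover have "H \<noteq> 0"
    using calculation n1 by (auto simp: N_def)
  ultimately have "Suc n + degree H = N"
    by (metis degree_0 degree_mult_eq nat.distinct(1))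
  then have "degree H < n * Suc n"
    by (simp add: N_def)
  \<comment> \<open>The added term of \<open>H\<close> has degree above \<open>degree H\<close>, so it cancels a term of \<open>P\<close>.\<close>
  then have "coeff H (n * Suc n) = 0"
    by (rule coeff_eq_0)
  moreover have "coeff H k = coeff P k" if "k \<noteq> n * Suc n" for k
    using that by (simp add: H_def XP)
  ultimately have "{k. coeff H k = 1} \<subseteq> {k. coeff P k = 1}"
    by (metis (mono_tags, lifting) Collect_mono bit_not_one_iff)
  then have "num_ones H \<le> num_ones P"
    unfolding num_ones_def by (rule card_mono[rotated]) simp
  also have "\<dots> \<le> (\<Prod>i<r. num_ones (1 + y ^ 2 ^ i))"
    unfolding P_def by (rule num_ones_prod_le)
  also have "\<dots> \<le> (\<Prod>i<r. 3)"
  proof (rule prod_mono, intro conjI)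
    fix i
    \<comment> \<open>By Frobenius this power of \<open>y\<close> is still a binomial, so each
      factor of \<open>P\<close> has at most three terms.\<close>
    have "y ^ 2 ^ i = (X ^ n) ^ 2 ^ i * (1 + X ^ 2 ^ i)"
      using bit_poly_power_two_power_add[of 1 X i] by (simp add: y_def power_mult_distrib)
    then have "1 + y ^ 2 ^ i = 1 + (monom 1 (n * 2 ^ i) + monom 1 (n * 2 ^ i + 2 ^ i))"
      by (simp add: XP[symmetric] power_mult power_add distrib_left)
    also have "num_ones \<dots> \<le> 1 + (1 + 1)"
      by (intro order_trans[OF num_ones_add_le] add_mono) simp_all
    finally show "num_ones (1 + y ^ 2 ^ i) \<le> 3" by simp
  qed simp
  finally have H3: "num_ones H \<le> 3 ^ r" by simp

  \<comment> \<open>\<open>F + X ^ n * H\<close> is the all-ones polynomial, so \<open>F\<close>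
    misses at most as many exponents as \<open>H\<close> has terms.\<close>
  have "N = num_ones (F + X ^ n * H)"
    unfolding F_def by (simp add: XP num_ones_all_ones add.assoc)
  also have "\<dots> \<le> num_ones F + num_ones (X ^ n * H)"
    by (rule num_ones_add_le)
  also have "num_ones (X ^ n * H) \<le> num_ones H"
    using num_ones_mult_le[of "X ^ n" H] by (simp add: XP)
  finally show thesis
    using that fF H3 unfolding N by fastforce
qed

text \<open>\<open>M\<close> counts the periods in 4^r - 1. With D the order and l the weight of the
  cofactor, gamma is l / D = M l / (D M), so this bound controls it whatever the value of
  \<open>M\<close>.\<close>

lemma f_r1_weight:
  assumes "r \<ge> 1"
  obtains M where "poly_ord (f_r1 r) * M = 4 ^ r - 1"
    "4 ^ r - 1 \<le> M * num_ones (cofactor (f_r1 r)) + 3 ^ r"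
proof -
  note f = f_r1_coeff_0[OF assms]
  obtain F where F: "f_r1 r * F = 1 + monom 1 (4 ^ r - 1)" "4 ^ r - 1 \<le> num_ones F + 3 ^ r"
    using f_r1_multiple[OF assms] .
  have "f_r1 r dvd 1 + monom 1 (4 ^ r - 1)"
    by (metis F(1) dvd_triv_left)
  then obtain M where M: "4 ^ r - 1 = poly_ord (f_r1 r) * M"
    using poly_ord_dvd[OF f] by (metis dvdE)
  have "num_ones F \<le> M * num_ones (cofactor (f_r1 r))"
    using F(1) unfolding M by (rule num_ones_le_cofactor[OF f])
  with F(2) M that show thesis by fastforce
qed

section \<open>Robustness and the limit\<close>

lemma weight_cofactor_f_r1:
  assumes "r \<ge> 1"
  shows "num_ones (cofactor (f_r1 r)) + num_zeros (poly_ord (f_r1 r) - 1) (cofactor (f_r1 r))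
    = poly_ord (f_r1 r)"
proof -
  \<comment> \<open>The positive degree of \<open>f_r1 r\<close> pushes that of its cofactor below
    the order, so the exponents up to the order minus 1 cover all its terms.\<close>
  have "degree (cofactor (f_r1 r)) \<le> poly_ord (f_r1 r) - 1"
    using degree_cofactor[OF f_r1_coeff_0[OF assms]] degree_f_r1[OF assms] by simp
  then show ?thesis
    using num_ones_plus_num_zeros poly_ord_props(1)[OF f_r1_coeff_0[OF assms]] by fastforce
qed

text \<open>The source of r >= 3: 62 < 64 at r = 3, while r = 2 gives 22 > 16.\<close>

lemma two_three_four_power_less: "r \<ge> 3 \<Longrightarrow> 2 * 3 ^ r + 2 ^ r < (4::nat) ^ r"
  by (induction r rule: dec_induct) simp_all

lemma robust_f_r1:
  assumes "r \<ge> 3"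
  shows "robust (f_r1 r)"
proof -
  define D l where "D = poly_ord (f_r1 r)" and "l = num_ones (cofactor (f_r1 r))"
  have r: "r \<ge> 1" using assms by simp
  obtain M where M: "D * M = 4 ^ r - 1" "4 ^ r - 1 \<le> M * l + 3 ^ r"
    using f_r1_weight[OF r] unfolding D_def l_def .
  \<comment> \<open>Since D is at least the degree 2^r + 1, this factorization forces M <= 2^r - 1,
    making the \<open>+ 1\<close> in robustness affordable after scaling by
    \<open>M\<close>.\<close>
  have "(4::nat) ^ r - 1 = (2 ^ r + 1) * (2 ^ r - 1)"
    by (simp add: algebra_simps flip: power_mult_distrib)
  moreover have "2 ^ r + 1 \<le> D"
    using degree_cofactor[OF f_r1_coeff_0[OF r]] degree_f_r1[OF r] by (simp add: D_def)
  ultimately have "(2 ^ r + 1) * M \<le> (2 ^ r + 1) * (2 ^ r - 1)"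
    using M(1) by (metis mult_le_mono1)
  then have "M \<le> 2 ^ r - 1"
    by (simp only: mult_le_cancel1)
  moreover have "(1::nat) \<le> 2 ^ r" "(1::nat) \<le> 4 ^ r" by simp_all
  ultimately have "D * M + M < 2 * (M * l)"
    using M two_three_four_power_less[OF assms] by linarith
  then have "M * (D + 1) < M * (2 * l)"
    by (simp add: algebra_simps)
  then have "D + 1 < 2 * l" by (simp only: mult_less_cancel1)
  then show ?thesis
    using weight_cofactor_f_r1[OF r] unfolding robust_def D_def l_def by linarith
qed

lemma gamma_ratio_f_r1_bounds:
  assumes "r \<ge> 1"
  shows "gamma_ratio (f_r1 r) \<le> 1" "1 - 2 * (3 / 4) ^ r \<le> gamma_ratio (f_r1 r)"
proof -
  define D l where "D = poly_ord (f_r1 r)" and "l = num_ones (cofactor (f_r1 r))"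
  have D: "D \<ge> 1"
    unfolding D_def by (rule poly_ord_props(1)[OF f_r1_coeff_0[OF assms]])
  have "l \<le> D"
    using weight_cofactor_f_r1[OF assms] unfolding D_def l_def by linarith
  with D show "gamma_ratio (f_r1 r) \<le> 1"
    by (simp add: gamma_ratio_def D_def[symmetric] l_def[symmetric])
  obtain M where M: "D * M = 4 ^ r - 1" "4 ^ r - 1 \<le> M * l + 3 ^ r"
    using f_r1_weight[OF assms] unfolding D_def l_def .
  have four: "(4::real) ^ r \<ge> 4"
    using power_increasing[OF assms, of "4::real"] by simp
  have "real (D * M) = 4 ^ r - 1"
    unfolding M(1) by (simp add: of_nat_diff)
  then have DM: "real D * real M = 4 ^ r - 1" by simp
  then have M0: "real M > 0"
    using four by (cases "M = 0") auto
  have "real (D * M) \<le> real (M * l + 3 ^ r)"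
    using M by (simp only: of_nat_le_iff)
  then have "(real D * real M - 3 ^ r) / (real D * real M) \<le> real M * real l / (real D * real M)"
    by (intro divide_right_mono) simp_all
  then have "1 - 3 ^ r / (real D * real M) \<le> real M * real l / (real D * real M)"
    using D M0 by (simp add: diff_divide_distrib)
  also have "\<dots> = gamma_ratio (f_r1 r)"
    using M0 by (simp add: gamma_ratio_def D_def l_def)
  finally have "1 - 3 ^ r / (4 ^ r - 1) \<le> gamma_ratio (f_r1 r)"
    unfolding DM .
  \<comment> \<open>Here 4^r - 1 >= 4^r / 2 turns the error into a geometric sequence; this is the
    factor 2 in the bound.\<close>
  moreover have "(3::real) ^ r / (4 ^ r - 1) \<le> 3 ^ r / (4 ^ r / 2)"
    by (rule divide_left_mono) (use four in auto)
  ultimately show "1 - 2 * (3 / 4) ^ r \<le> gamma_ratio (f_r1 r)"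
    by (simp add: power_divide)
qed

theorem mainTheorem1:
  shows "(\<forall>r\<ge>3. robust (f_r1 r) \<and> poly_ord (f_r1 r) dvd 4 ^ r - 1) \<and>
         (\<lambda>r. gamma_ratio (f_r1 r)) \<longlonglongrightarrow> 1"
proof (intro conjI allI impI)
  fix r :: nat assume "r \<ge> 3"
  then show "robust (f_r1 r)"
    by (rule robust_f_r1)
  from \<open>r \<ge> 3\<close> have "r \<ge> 1" by simp
  then show "poly_ord (f_r1 r) dvd 4 ^ r - 1"
    using f_r1_weight by (metis dvd_triv_left)
next
  show "(\<lambda>r. gamma_ratio (f_r1 r)) \<longlonglongrightarrow> 1"
  proof (rule tendsto_sandwich)
    have "(\<lambda>r. 1 - 2 * (3 / 4 :: real) ^ r) \<longlonglongrightarrow> 1 - 2 * 0"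
      by (intro tendsto_intros LIMSEQ_realpow_zero) auto
    then show "(\<lambda>r. 1 - 2 * (3 / 4 :: real) ^ r) \<longlonglongrightarrow> 1" by simp
    show "\<forall>\<^sub>F r in sequentially. 1 - 2 * (3 / 4) ^ r \<le> gamma_ratio (f_r1 r)"
      using eventually_ge_at_top[of 1] by eventually_elim (rule gamma_ratio_f_r1_bounds)
    show "\<forall>\<^sub>F r in sequentially. gamma_ratio (f_r1 r) \<le> 1"
      using eventually_ge_at_top[of 1] by eventually_elim (rule gamma_ratio_f_r1_bounds)
  qed simp
qed

end
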